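(* Let $\mathcal{G}$ be a Hausdorff topological group for which there exists $\Delta_0\in\mathsf{RP}(\mathcal{G})$ such that $\eta^{\sharp}(\Delta_0)=\mathfrak{B}_{\mathcal{G}}$. Then there are a point $\nu\in\mathcal{G}^{\mathsf{LUC}}\setminus\mathcal{G}$ and a net $(\nu_{\gamma})_{\gamma\in\Gamma}$ in $\mathcal{G}^{\mathsf{LUC}}\setminus\mathcal{G}$ such that: (1) $\lim_{\gamma\in\Gamma}\nu_{\gamma}=\nu$, with the limit taken in $\mathcal{G}^{\mathsf{LUC}}$; and (2) if $\mu\in\mathsf{LUC}(\mathcal{G})^*$ and $\mu\star\nu_{\gamma}$ converges to $\mu\star\nu$ in the $w^*$-topology of $\mathsf{LUC}(\mathcal{G})^*$ (along $\gamma\in\Gamma$), then $\mu\in\mathsf{M_u}(\mathcal{G})$.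
   Context: All topological groups are Hausdorff; $e$ denotes the identity of $\mathcal{G}$. $\mathsf{RP}(\mathcal{G})$ is the set of all right-invariant continuous pseudometrics on $\mathcal{G}$. $\mathcal{G}$ is regarded as a uniform space with the uniformity induced by $\mathsf{RP}(\mathcal{G})$, and $\mathsf{LUC}(\mathcal{G})$ is the Banach space, with sup norm, of bounded complex-valued uniformly continuous functions on this uniform space. For $x\in\mathcal{G}$ and a function $f$ on $\mathcal{G}$, let $\mathsf{L}_xf(y)=f(xy)$. For $\nu\in\mathsf{LUC}(\mathcal{G})^*$ and $f\in\mathsf{LUC}(\mathcal{G})$, the function $\nu\bullet f\in\mathsf{LUC}(\mathcal{G})$ is defined by $(\nu\bullet f)(x)=\langle\nu,\mathsf{L}_xf\rangle$ for $x\in\mathcal{G}$. The convolution on $\mathsf{LUC}(\mathcal{G})^*$ is $\langle\mu\star\nu,f\rangle=\langle\mu,\nu\bullet f\rangle$ for $\mu,\nu\in\mathsf{LUC}(\mathcal{G})^*$ and $f\in\mathsf{LUC}(\mathcal{G})$; it makes $\mathsf{LUC}(\mathcal{G})^*$ a Banach algebra. For $x\in\mathcal{G}$, $\delta(x)\in\mathsf{LUC}(\mathcal{G})^*$ is the point evaluation at $x$. $\mathcal{G}^{\mathsf{LUC}}$ is the $w^*$-closure of $\delta[\mathcal{G}]$ in $\mathsf{LUC}(\mathcal{G})^*$, with the $w^*$-topology (the uniform compactification of $\mathcal{G}$). $\mathcal{G}$ is identified with $\delta[\mathcal{G}]$, so $\mathcal{G}\subseteq\mathcal{G}^{\mathsf{LUC}}\subseteq\mathsf{LUC}(\mathcal{G})^*$.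 For $\Delta\in\mathsf{RP}(\mathcal{G})$ put $\mathsf{BLip_b}^+(\Delta)=\{f:\mathcal{G}\to[0,1] : |f(x)-f(y)|\le\Delta(x,y)\text{ for all }x,y\in\mathcal{G}\}$ and $\mathsf{B}(\Delta)=\{x\in\mathcal{G}:\Delta(e,x)<1\}$. The space $\mathsf{M_u}(\mathcal{G})$ of uniform measures is the set of $\mu\in\mathsf{LUC}(\mathcal{G})^*$ such that, for every $\Delta\in\mathsf{RP}(\mathcal{G})$, the restriction of $\mu$ to $\mathsf{BLip_b}^+(\Delta)$ is continuous for the topology of pointwise convergence on $\mathcal{G}$. For an infinite cardinal $\kappa$, $\mathcal{G}$ is $\kappa$-bounded if for every neighbourhood $U$ of $e$ there is $A\subseteq\mathcal{G}$ with $|A|\le\kappa$ and $\mathcal{G}=UA$ (equivalently, for every $\Delta\in\mathsf{RP}(\mathcal{G})$ there is $A\subseteq\mathcal{G}$ with $|A|\le\kappa$ and $\mathcal{G}=\mathsf{B}(\Delta)A$). $\mathfrak{B}_{\mathcal{G}}$ is the least infinite cardinal $\kappa$ for which $\mathcal{G}$ is $\kappa$-bounded. For $\Delta\in\mathsf{RP}(\mathcal{G})$, $\eta^{\sharp}(\Delta)$ is the least (finite or infinite) cardinal $\kappa$ for which there is $A\subseteq\mathcal{G}$ of cardinality $\kappa$ with $\mathcal{G}=\mathsf{B}(\Delta)A$. *)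

theory Defs
  imports "HOL-Analysis.Analysis"
begin

unbundle cardinal_syntax

text \<open>
  Topological groups are types of class \<open>topological_group_add\<close>. The class \<open>group_add\<close> does
  not include commutativity, so these are arbitrary topological groups, written
  additively: \<open>x + y\<close> is the product $xy$ and \<open>0\<close> is the identity $e$.
\<close>

section \<open>Right-invariant pseudometrics and the right uniformity\<close>

definition RP :: "('a::topological_group_add \<Rightarrow> 'a \<Rightarrow> real) set" where
  "RP = {\<Delta>. (\<forall>x. \<Delta> x x = 0) \<and> (\<forall>x y. 0 \<le> \<Delta> x y) \<and> (\<forall>x y. \<Delta> x y = \<Delta> y x) \<and>
      (\<forall>x y z. \<Delta> x z \<le> \<Delta> x y + \<Delta> y z) \<and>
      (\<forall>x y z. \<Delta> (x + z) (y + z) = \<Delta> x y) \<and>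
      continuous_on UNIV (\<lambda>(x, y). \<Delta> x y)}"

definition RP_uniformity :: "('a::topological_group_add \<times> 'a) filter" where
  "RP_uniformity = (INF \<Delta>\<in>RP. INF \<epsilon>\<in>{0<..}. principal {(x, y). \<Delta> x y < \<epsilon>})"

text \<open>Uniform continuity below is worded as in \<open>uniformly_continuous_on_uniformity\<close>, with
  \<open>RP_uniformity\<close> on the domain; the type \<open>'a\<close> itself carries no uniformity.\<close>

definition LUC :: "('a::topological_group_add \<Rightarrow> complex) set" where
  "LUC = {f. bounded (range f) \<and> (LIM (x, y) RP_uniformity. (f x, f y) :> uniformity)}"

definition sup_norm :: "('a \<Rightarrow> complex) \<Rightarrow> real" where
  "sup_norm f = (SUP x. cmod (f x))"

section \<open>The dual of LUC and its weak-star topology\<close>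

text \<open>A functional on \<open>LUC\<close> is represented by an extensional function (\<open>undefined\<close> off
  \<open>LUC\<close>), so that equality of functionals is equality in HOL.\<close>

definition LUC_dual :: "(('a::topological_group_add \<Rightarrow> complex) \<Rightarrow> complex) set" where
  "LUC_dual = {\<mu> \<in> extensional LUC.
      (\<forall>f\<in>LUC. \<forall>g\<in>LUC. \<mu> (\<lambda>x. f x + g x) = \<mu> f + \<mu> g) \<and>
      (\<forall>c. \<forall>f\<in>LUC. \<mu> (\<lambda>x. c * f x) = c * \<mu> f) \<and>
      (\<exists>K. \<forall>f\<in>LUC. cmod (\<mu> f) \<le> K * sup_norm f)}"

definition weak_star :: "(('a::topological_group_add \<Rightarrow> complex) \<Rightarrow> complex) topology" where
  "weak_star = subtopology (product_topology (\<lambda>_. euclidean) LUC) LUC_dual"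

definition ltrans :: "'a::topological_group_add \<Rightarrow> ('a \<Rightarrow> complex) \<Rightarrow> 'a \<Rightarrow> complex" where
  "ltrans x f = (\<lambda>y. f (x + y))"

definition luc_act ::
  "(('a::topological_group_add \<Rightarrow> complex) \<Rightarrow> complex) \<Rightarrow> ('a \<Rightarrow> complex) \<Rightarrow> 'a \<Rightarrow> complex"
  (infixr \<open>\<bullet>\<^sub>L\<close> 75) where
  "\<nu> \<bullet>\<^sub>L f = (\<lambda>x. \<nu> (ltrans x f))"

definition conv ::
  "(('a::topological_group_add \<Rightarrow> complex) \<Rightarrow> complex) \<Rightarrow> (('a \<Rightarrow> complex) \<Rightarrow> complex) \<Rightarrow>
    (('a \<Rightarrow> complex) \<Rightarrow> complex)"
  (infixl \<open>\<star>\<close> 70) where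
  "\<mu> \<star> \<nu> = (\<lambda>f\<in>LUC. \<mu> (\<nu> \<bullet>\<^sub>L f))"

definition point_eval :: "'a::topological_group_add \<Rightarrow> ('a \<Rightarrow> complex) \<Rightarrow> complex" where
  "point_eval x = (\<lambda>f\<in>LUC. f x)"

definition G_LUC :: "(('a::topological_group_add \<Rightarrow> complex) \<Rightarrow> complex) set" where
  "G_LUC = weak_star closure_of (range point_eval)"

section \<open>Uniform measures\<close>

definition BLip :: "('a \<Rightarrow> 'a \<Rightarrow> real) \<Rightarrow> ('a \<Rightarrow> complex) set" where
  "BLip \<Delta> = {\<lambda>x. complex_of_real (f x) | f.
      (\<forall>x. f x \<in> {0..1}) \<and> (\<forall>x y. \<bar>f x - f y\<bar> \<le> \<Delta> x y)}"

text \<open>The topology of the function type \<open>'a \<Rightarrow> complex\<close> in \<open>continuous_on\<close> is the product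
  topology, that is, the topology of pointwise convergence on the group.\<close>

definition uniform_measures :: "(('a::topological_group_add \<Rightarrow> complex) \<Rightarrow> complex) set" where
  "uniform_measures = {\<mu> \<in> LUC_dual. \<forall>\<Delta>\<in>RP. continuous_on (BLip \<Delta>) \<mu>}"

section \<open>Covering cardinals\<close>

text \<open>\<open>U + A\<close> for sets is the elementwise product set $UA$ of \<open>HOL-Library.Set_Algebras\<close>.
  Cardinals are represented by well-orders \<open>\<kappa>\<close> with \<open>Card_order \<kappa>\<close>, up to \<open>=o\<close>.
  \<open>least_card P\<close> is the least cardinal with property \<open>P\<close> among those realised on a given
  type. Both types chosen below are large enough for this to be the least cardinal outright:
  see \<open>eta_sharp_least\<close> and \<open>bounding_cardinal_least\<close>, where the competing cardinals live on
  arbitrary types.\<close>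

definition least_card :: "('k rel \<Rightarrow> bool) \<Rightarrow> 'k rel" where
  "least_card P =
    (SOME \<kappa>. Card_order \<kappa> \<and> P \<kappa> \<and> (\<forall>\<kappa>'. Card_order \<kappa>' \<and> P \<kappa>' \<longrightarrow> \<kappa> \<le>o \<kappa>'))"

definition unit_ball :: "('a::topological_group_add \<Rightarrow> 'a \<Rightarrow> real) \<Rightarrow> 'a set" where
  "unit_ball \<Delta> = {x. \<Delta> 0 x < 1}"

definition eta_sharp :: "('a::topological_group_add \<Rightarrow> 'a \<Rightarrow> real) \<Rightarrow> 'a rel" where
  "eta_sharp \<Delta> =
    least_card (\<lambda>\<kappa>. \<exists>A. |A| =o \<kappa> \<and> unit_ball \<Delta> + A = UNIV)"

definition kappa_bounded :: "'a::topological_group_add itself \<Rightarrow> 'k rel \<Rightarrow> bool" where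
  "kappa_bounded _ \<kappa> \<longleftrightarrow>
    (\<forall>U::'a set. 0 \<in> interior U \<longrightarrow> (\<exists>A. |A| \<le>o \<kappa> \<and> U + A = UNIV))"

text \<open>The summand \<open>nat\<close> provides infinite cardinals also when the group is finite.\<close>

definition bounding_cardinal :: "(nat + 'a::topological_group_add) rel" where
  "bounding_cardinal = least_card (\<lambda>\<kappa>. infinite (Field \<kappa>) \<and> kappa_bounded TYPE('a) \<kappa>)"

section \<open>Nets\<close>

definition directed :: "'i set \<Rightarrow> ('i \<Rightarrow> 'i \<Rightarrow> bool) \<Rightarrow> bool" where
  "directed \<Gamma> le \<longleftrightarrow> \<Gamma> \<noteq> {} \<and> (\<forall>a\<in>\<Gamma>. le a a) \<and>
    (\<forall>a\<in>\<Gamma>. \<forall>b\<in>\<Gamma>. \<forall>c\<in>\<Gamma>. le a b \<longrightarrow> le b c \<longrightarrow> le a c) \<and>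
    (\<forall>a\<in>\<Gamma>. \<forall>b\<in>\<Gamma>. \<exists>c\<in>\<Gamma>. le a c \<and> le b c)"

definition along :: "'i set \<Rightarrow> ('i \<Rightarrow> 'i \<Rightarrow> bool) \<Rightarrow> 'i filter" where
  "along \<Gamma> le = (INF a\<in>\<Gamma>. principal {b \<in> \<Gamma>. le a b})"

text \<open>A net in \<open>'b\<close> converges exactly as its filter of tails does, and a filter \<open>F\<close> on \<open>'b\<close> is
  the tail filter of a net indexed by the pairs \<open>(S, s)\<close> with \<open>s \<in> S\<close> and \<open>S\<close> in \<open>F\<close>, directed
  by reverse inclusion of the sets \<open>S\<close>. Hence the following index type loses no generality
  when the existence of a net in \<open>'b\<close> with given convergence properties is asserted.\<close>

type_synonym 'b net_index = "'b set \<times> 'b"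

section \<open>Well-definedness\<close>

lemma eventually_along:
  assumes "directed \<Gamma> le"
  shows "eventually P (along \<Gamma> le) \<longleftrightarrow> (\<exists>a\<in>\<Gamma>. \<forall>b\<in>\<Gamma>. le a b \<longrightarrow> P b)"
proof -
  have ne: "\<Gamma> \<noteq> {}"
    using assms by (simp add: directed_def)
  have dir: "\<exists>x\<in>\<Gamma>. principal {c \<in> \<Gamma>. le x c} \<le> inf (principal {c \<in> \<Gamma>. le a c})
      (principal {c \<in> \<Gamma>. le b c})"
    if ab: "a \<in> \<Gamma>" "b \<in> \<Gamma>" for a b
  proof -
    obtain x where x: "x \<in> \<Gamma>" "le a x" "le b x"
      using assms ab unfolding directed_def by blast
    have trans: "le p r" if "p \<in> \<Gamma>" "q \<in> \<Gamma>" "r \<in> \<Gamma>" "le p q" "le q r" for p q r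
      using assms that unfolding directed_def by blast
    have "{c \<in> \<Gamma>. le x c} \<subseteq> {c \<in> \<Gamma>. le a c}" "{c \<in> \<Gamma>. le x c} \<subseteq> {c \<in> \<Gamma>. le b c}"
      using x ab trans by blast+
    then show ?thesis
      using x(1) by (intro bexI[of _ x]) auto
  qed
  have "eventually P (along \<Gamma> le) \<longleftrightarrow> (\<exists>a\<in>\<Gamma>. eventually P (principal {b \<in> \<Gamma>. le a b}))"
    unfolding along_def by (rule eventually_INF_base[OF ne]) (rule dir)
  then show ?thesis
    by (auto simp: eventually_principal)
qed

lemma least_card:
  assumes "Card_order \<kappa>" "P \<kappa>"
  shows "Card_order (least_card P)" "P (least_card P)"
    and "\<And>\<kappa>'. Card_order \<kappa>' \<Longrightarrow> P \<kappa>' \<Longrightarrow> least_card P \<le>o \<kappa>'"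
proof -
  have "\<exists>\<kappa>. Card_order \<kappa> \<and> P \<kappa> \<and> (\<forall>\<kappa>'. Card_order \<kappa>' \<and> P \<kappa>' \<longrightarrow> \<kappa> \<le>o \<kappa>')"
    using exists_minim_Card_order[of "{\<kappa>. Card_order \<kappa> \<and> P \<kappa>}"] assms by blast
  then have *: "Card_order (least_card P) \<and> P (least_card P) \<and>
      (\<forall>\<kappa>'. Card_order \<kappa>' \<and> P \<kappa>' \<longrightarrow> least_card P \<le>o \<kappa>')"
    unfolding least_card_def by (rule someI_ex)
  show "Card_order (least_card P)"
    using * by (rule conjunct1)
  show "P (least_card P)"
    using * by (elim conjE)
  show "least_card P \<le>o \<kappa>'" if "Card_order \<kappa>'" "P \<kappa>'" for \<kappa>'
    using * that by simp
qed

lemma zero_in_plus_UNIV: "0 \<in> U \<Longrightarrow> U + UNIV = (UNIV :: 'a::monoid_add set)"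
proof -
  assume "0 \<in> U"
  then have "x \<in> U + UNIV" for x
    using set_plus_intro[of 0 U x UNIV] by simp
  then show ?thesis by blast
qed

lemma eta_sharp_least:
  fixes \<Delta> :: "'a::topological_group_add \<Rightarrow> 'a \<Rightarrow> real"
  assumes "\<Delta> \<in> RP"
  shows "Card_order (eta_sharp \<Delta>)"
    and "\<exists>A. |A| =o eta_sharp \<Delta> \<and> unit_ball \<Delta> + A = UNIV"
    and "\<And>A. unit_ball \<Delta> + A = UNIV \<Longrightarrow> eta_sharp \<Delta> \<le>o |A|"
proof -
  let ?P = "\<lambda>\<kappa>::'a rel. \<exists>A. |A| =o \<kappa> \<and> unit_ball \<Delta> + A = UNIV"
  have "0 \<in> unit_ball \<Delta>"
    using assms by (simp add: unit_ball_def RP_def)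
  then have "unit_ball \<Delta> + UNIV = UNIV"
    by (rule zero_in_plus_UNIV)
  then have P: "?P |UNIV|"
    by (intro exI conjI) (rule card_of_refl)
  note lc = least_card[of "|UNIV|" ?P, OF card_of_Card_order P, folded eta_sharp_def]
  show "Card_order (eta_sharp \<Delta>)"
    "\<exists>A. |A| =o eta_sharp \<Delta> \<and> unit_ball \<Delta> + A = UNIV"
    by (rule lc(1), rule lc(2))
  show "eta_sharp \<Delta> \<le>o |A|"
    if "unit_ball \<Delta> + A = UNIV" for A
    by (rule lc(3)[OF card_of_Card_order]) (intro exI conjI, rule card_of_refl, rule that)
qed

lemma kappa_bounded_mono:
  "kappa_bounded TYPE('a::topological_group_add) \<kappa> \<Longrightarrow> \<kappa> \<le>o \<kappa>' \<Longrightarrow> kappa_bounded TYPE('a) \<kappa>'"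
  unfolding kappa_bounded_def using ordLeq_transitive[of _ \<kappa> \<kappa>'] by fast

lemma bounding_cardinal_least:
  defines "\<BB> \<equiv> bounding_cardinal :: (nat + 'a::topological_group_add) rel"
  shows "Card_order \<BB>" "infinite (Field \<BB>)" "kappa_bounded TYPE('a) \<BB>"
    and "\<And>\<kappa> :: 'k rel. Card_order \<kappa> \<Longrightarrow> infinite (Field \<kappa>) \<Longrightarrow> kappa_bounded TYPE('a) \<kappa> \<Longrightarrow> \<BB> \<le>o \<kappa>"
proof -
  let ?P = "\<lambda>\<kappa>::(nat + 'a) rel. infinite (Field \<kappa>) \<and> kappa_bounded TYPE('a) \<kappa>"
  let ?T = "|UNIV :: (nat + 'a) set|"
  have "|UNIV :: 'a set| \<le>o ?T"
    using card_of_Plus2[of "UNIV :: 'a set" "UNIV :: nat set"] by (simp only: UNIV_Plus_UNIV)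
  moreover have "U + UNIV = UNIV" if "0 \<in> interior U" for U :: "'a set"
    using that interior_subset by (intro zero_in_plus_UNIV) blast
  ultimately have "kappa_bounded TYPE('a) ?T"
    unfolding kappa_bounded_def by blast
  moreover have "infinite (UNIV :: (nat + 'a) set)"
    by simp
  ultimately have P: "?P ?T"
    unfolding Field_card_of by blast
  note lc = least_card[of ?T ?P, OF card_of_Card_order P, folded bounding_cardinal_def \<BB>_def]
  show "Card_order \<BB>" "infinite (Field \<BB>)" "kappa_bounded TYPE('a) \<BB>"
    by (rule lc(1), rule conjunct1[OF lc(2)], rule conjunct2[OF lc(2)])
  show "\<BB> \<le>o \<kappa>" if \<kappa>: "Card_order \<kappa>" "infinite (Field \<kappa>)" "kappa_bounded TYPE('a) \<kappa>"
    for \<kappa> :: "'k rel"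
  proof (rule ccontr)
    assume "\<not> \<BB> \<le>o \<kappa>"
    then have less: "\<kappa> <o \<BB>"
      using not_ordLeq_iff_ordLess[OF card_order_on_well_order_on[OF \<kappa>(1)]
          card_order_on_well_order_on[OF lc(1)]] by simp
    then have "|Field \<kappa>| \<le>o |Field \<BB>|"
      by (intro card_of_mono2 ordLess_imp_ordLeq)
    then obtain f where f: "inj_on f (Field \<kappa>)" "f ` Field \<kappa> \<subseteq> Field \<BB>"
      unfolding card_of_ordLeq[symmetric] by blast
    let ?k = "|f ` Field \<kappa>|"
    have "bij_betw f (Field \<kappa>) (f ` Field \<kappa>)"
      using f(1) by (rule inj_on_imp_bij_betw)
    then have "|Field \<kappa>| =o ?k"
      by (rule card_of_ordIsoI)
    then have eq: "\<kappa> =o ?k"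
      by (rule ordIso_transitive[OF ordIso_symmetric[OF card_of_Field_ordIso[OF \<kappa>(1)]]])
    have "kappa_bounded TYPE('a) ?k"
      using \<kappa>(3) ordIso_imp_ordLeq[OF eq] by (rule kappa_bounded_mono)
    moreover have "infinite (f ` Field \<kappa>)"
      using \<kappa>(2) f(1) finite_imageD by blast
    ultimately have "?P ?k"
      unfolding Field_card_of by blast
    then have "\<BB> \<le>o ?k"
      by (rule lc(3)[OF card_of_Card_order])
    then have "\<BB> \<le>o \<kappa>"
      using ordIso_symmetric[OF eq] by (rule ordLeq_ordIso_trans)
    then show False using \<open>\<not> \<BB> \<le>o \<kappa>\<close> by simp
  qed
qed

end

theory Submission
  imports Defs
begin

text \<open>
  Let \<open>K\<close> be a set of size \<open>\<BB>\<close> and \<open>e\<close> a \<open>\<Delta>\<^sub>0\<close>-dense family of points indexed by \<open>K\<close>. A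
  Neumann-type covering argument and transfinite recursion give points \<open>x (E, F)\<close>, for finite
  \<open>E, F \<subseteq> K\<close>, such that the finite sets \<open>e ` E + x (E, F)\<close> are mutually \<open>\<Delta>\<^sub>0\<close>-separated. Let
  \<open>\<nu>\<^sub>F\<close> be a cluster point of \<open>x (E, F)\<close> as \<open>E\<close> grows, and \<open>\<nu>\<close> a cluster point of \<open>\<nu>\<^sub>F\<close> as
  \<open>F\<close> grows. By separation, for any functions \<open>g\<^sub>F\<close> in one \<open>BLip \<Delta>\<close> there is a single \<open>f\<close> in LUC
  with \<open>f (y + x (E, F)) = g\<^sub>F y\<close> whenever \<open>y\<close> is close to \<open>e ` E\<close>; then \<open>\<nu>\<^sub>F \<bullet>\<^sub>L f = g\<^sub>F\<close>, and
  \<open>\<nu> \<bullet>\<^sub>L f = h\<close> if \<open>g\<^sub>F\<close> tends to \<open>h\<close> pointwise. If \<open>\<mu>\<close> is discontinuous at \<open>h\<close> on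
  \<open>BLip \<Delta>\<close>, choose \<open>g\<^sub>F\<close> close to \<open>h\<close> on the part indexed by \<open>F\<close> of a \<open>\<Delta>\<close>-dense family
  indexed by \<open>K\<close>, but with \<open>\<mu> g\<^sub>F\<close> far from \<open>\<mu> h\<close>: then \<open>\<mu> \<star> \<nu>\<^sub>F\<close> does not converge to
  \<open>\<mu> \<star> \<nu>\<close> at \<open>f\<close>. The point is that \<open>\<nu>\<^sub>F\<close> depends only on the index set \<open>K\<close>, not on \<open>\<Delta>\<close>.
\<close>

section \<open>Cardinality\<close>

text \<open>Induction on the size: a set with one more element comes from a pair in \<open>K\<close>
  times the smaller sets, so each size contributes at most \<open>|K|\<close> sets, and there are
  countably many sizes.\<close>

lemma card_of_Fpow_ordLeq_infinite:
  assumes "infinite K"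
  shows "|Fpow K| \<le>o |K|"
proof -
  have *: "|{E. E \<subseteq> K \<and> finite E \<and> card E = n}| \<le>o |K|" for n
  proof (induction n)
    case 0
    have "{E. E \<subseteq> K \<and> finite E \<and> card E = 0} = {{}}"
      by auto
    then show ?case
      using assms by (simp add: card_of_singl_ordLeq infinite_imp_nonempty)
  next
    case (Suc n)
    let ?P = "K \<times> {E. E \<subseteq> K \<and> finite E \<and> card E = n}"
    have "{E. E \<subseteq> K \<and> finite E \<and> card E = Suc n} \<subseteq> (\<lambda>(k, E). insert k E) ` ?P"
    proof
      fix E assume E: "E \<in> {E. E \<subseteq> K \<and> finite E \<and> card E = Suc n}"
      then obtain k where "k \<in> E"
        by fastforce
      with E show "E \<in> (\<lambda>(k, E). insert k E) ` ?P"
        by (intro image_eqI[of _ _ "(k, E - {k})"]) (auto simp: insert_absorb)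
    qed
    then have "|{E. E \<subseteq> K \<and> finite E \<and> card E = Suc n}| \<le>o |?P|"
      by (rule surj_imp_ordLeq)
    also have "|?P| \<le>o |K|"
      using assms Suc by (intro card_of_Sigma_ordLeq_infinite) (auto intro: card_of_mono1)
    finally show ?case .
  qed
  have "Fpow K = (\<Union>n::nat. {E. E \<subseteq> K \<and> finite E \<and> card E = n})"
    by (auto simp: Fpow_def)
  then show ?thesis
    using * assms by (simp only:) (intro card_of_UNION_ordLeq_infinite,
        auto simp flip: infinite_iff_card_of_nat)
qed

lemma card_of_Times_ordLess:
  assumes r: "Card_order r" "infinite (Field r)" and "|A| <o r" "|B| <o r"
  shows "|A \<times> B| <o r"
proof (cases "finite A \<and> finite B")
  case True
  then show ?thesis
    using r by (intro finite_ordLess_infinite[OF card_of_Well_order])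
      (auto simp: card_order_on_well_order_on Field_card_of)
next
  case False
  have "|A \<times> B| \<le>o |A| \<or> |A \<times> B| \<le>o |B|"
  proof (cases "|A| \<le>o |B|")
    case True
    then have "infinite B"
      using False card_of_ordLeq_finite by blast
    then show ?thesis
      using True by (intro disjI2 card_of_Sigma_ordLeq_infinite) (auto intro: card_of_mono1)
  next
    case notle: False
    then have "|B| \<le>o |A|"
      using ordLeq_total[OF card_of_Well_order card_of_Well_order] by blast
    moreover from this have "infinite A"
      using False card_of_ordLeq_finite by blast
    ultimately show ?thesis
      by (intro disjI1 card_of_Sigma_ordLeq_infinite) (auto intro: card_of_mono1)
  qed
  then show ?thesis
    using ordLeq_ordLess_trans[OF _ assms(3)] ordLeq_ordLess_trans[OF _ assms(4)] by blast
qed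

text \<open>Since the members are finite, the union is finite or no larger than \<open>I\<close>;
  this way the bound holds for singular \<open>r\<close> too.\<close>

lemma card_of_UNION_finite_ordLess:
  assumes r: "Card_order r" "infinite (Field r)" and I: "|I| <o r" and A: "\<And>i. i \<in> I \<Longrightarrow> finite (A i)"
  shows "|\<Union>i\<in>I. A i| <o r"
proof (cases "finite I")
  case True
  then have "finite (\<Union>i\<in>I. A i)"
    using A by blast
  then show ?thesis
    using r by (intro finite_ordLess_infinite[OF card_of_Well_order])
      (auto simp: card_order_on_well_order_on Field_card_of)
next
  case False
  then have "|\<Union>i\<in>I. A i| \<le>o |I|"
    using A ordLess_imp_ordLeq[OF finite_ordLess_infinite[OF card_of_Well_order card_of_Well_order]]
    by (intro card_of_UNION_ordLeq_infinite) (auto simp: Field_card_of intro: card_of_mono1)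
  then show ?thesis
    using I ordLeq_ordLess_trans by blast
qed

text \<open>If no \<open>g\<close> makes \<open>B\<^sub>i + g\<close> disjoint from \<open>B\<^sub>i + A\<^sub>i\<close>, the index \<open>i\<close> is as required. Otherwise
  \<open>B\<^sub>i + g\<close>, and hence \<open>B\<^sub>i + A\<^sub>i\<close>, is covered by the other sets, and \<open>i\<close> can be dropped.\<close>

lemma finite_cover_by_translates:
  fixes B :: "'i \<Rightarrow> 'a::group_add set"
  assumes r: "Card_order r" "infinite (Field r)"
  assumes "finite I" "\<And>i. i \<in> I \<Longrightarrow> |A i| <o r" "(\<Union>i\<in>I. B i + A i) = UNIV"
  shows "\<exists>i\<in>I. \<exists>C. |C| <o r \<and> (\<forall>y. \<exists>b\<in>B i. \<exists>b'\<in>B i. \<exists>c\<in>C. y = - b + b' + c)"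
  using assms(3-)
proof (induction I arbitrary: A)
  case empty
  then show ?case by simp
next
  case (insert j I)
  show ?case
  proof (cases "\<forall>g. \<exists>b\<in>B j. \<exists>b'\<in>B j. \<exists>a\<in>A j. b + g = b' + a")
    case True
    have "\<exists>b\<in>B j. \<exists>b'\<in>B j. \<exists>c\<in>A j. y = - b + b' + c" for y
    proof -
      obtain b b' a where "b \<in> B j" "b' \<in> B j" "a \<in> A j" "b + y = b' + a"
        using True by blast
      moreover from this have "y = - b + b' + a"
        by (metis add.assoc minus_add_cancel)
      ultimately show ?thesis by blast
    qed
    then show ?thesis
      using insert.prems by blast
  next
    case False
    then obtain g where g: "\<And>b b' a. b \<in> B j \<Longrightarrow> b' \<in> B j \<Longrightarrow> a \<in> A j \<Longrightarrow> b + g \<noteq> b' + a"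
      by blast
    \<comment> \<open>From \<open>b + g = b' + a'\<close> with \<open>b'\<close> in another set
      \<open>B i\<close> it follows that \<open>b + a = b' + (a' - g + a)\<close>. These are the
      extra translates that take over the part \<open>B j + A j\<close>.\<close>
    define A' where "A' i = A i \<union> (\<lambda>(a, a'). a - g + a') ` (A i \<times> A j)" for i
    have "|A' i| <o r" if "i \<in> I" for i
    proof -
      have "|A i \<times> A j| <o r"
        using insert.prems that by (intro card_of_Times_ordLess[OF r]) auto
      then have "|(\<lambda>(a, a'). a - g + a') ` (A i \<times> A j)| <o r"
        using card_of_image ordLeq_ordLess_trans by blast
      then show ?thesis
        unfolding A'_def using insert.prems that r by (intro card_of_Un_ordLess_infinite_Field) auto
    qed
    moreover have "(\<Union>i\<in>I. B i + A' i) = UNIV"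
    proof -
      have "\<exists>i\<in>I. y \<in> B i + A' i" for y
      proof -
        obtain i where i: "i \<in> insert j I" "y \<in> B i + A i"
          using insert.prems(2) by blast
        show ?thesis
        proof (cases "i \<in> I")
          case True
          then show ?thesis
            using i unfolding A'_def set_plus_def by blast
        next
          case False
          then obtain b a where ba: "b \<in> B j" "a \<in> A j" "y = b + a"
            using i by (auto elim: set_plus_elim)
          obtain i' where i': "i' \<in> insert j I" "b + g \<in> B i' + A i'"
            using insert.prems(2) by blast
          then obtain b' a' where ba': "b' \<in> B i'" "a' \<in> A i'" "b + g = b' + a'"
            by (auto elim: set_plus_elim)
          have "i' \<in> I"
            using i' ba' g ba(1) by blast
          moreover have "y = b' + (a' - g + a)"
            using ba(3) ba'(3) by (metis add.assoc add_diff_cancel diff_conv_add_uminus)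
          moreover have "a' - g + a \<in> A' i'"
            unfolding A'_def using ba ba' by force
          ultimately show ?thesis
            using ba'(1) by blast
        qed
      qed
      then show ?thesis by blast
    qed
    ultimately show ?thesis
      using insert.IH by blast
  qed
qed

section \<open>Right-invariant pseudometrics\<close>

lemma RP_D:
  assumes "\<Delta> \<in> RP"
  shows "\<Delta> x x = 0" "0 \<le> \<Delta> x y" "\<Delta> x y = \<Delta> y x" "\<Delta> x z \<le> \<Delta> x y + \<Delta> y z"
    "\<Delta> (x + z) (y + z) = \<Delta> x y" "continuous_on UNIV (\<lambda>(x, y). \<Delta> x y)"
  using assms by (simp_all add: RP_def)

lemma RP_abs_diff_le:
  assumes "\<Delta> \<in> RP"
  shows "\<bar>\<Delta> x z - \<Delta> y z\<bar> \<le> \<Delta> x y"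
  using RP_D(4)[OF assms, of x z y] RP_D(4)[OF assms, of y z x] RP_D(3)[OF assms, of x y] by linarith

text \<open>Left and right translations commute, so right invariance survives. This substitutes for
  left invariance, which \<open>\<Delta>\<close> may lack.\<close>

lemma RP_ltrans:
  assumes "\<Delta> \<in> RP"
  shows "(\<lambda>x y. \<Delta> (g + x) (g + y)) \<in> RP"
proof -
  have "continuous_on UNIV ((\<lambda>(x, y). \<Delta> x y) \<circ> (\<lambda>p. (g + fst p, g + snd p)))"
    by (intro continuous_on_compose continuous_on_subset[OF RP_D(6)[OF assms]] continuous_intros) auto
  then have "continuous_on UNIV (\<lambda>(x, y). \<Delta> (g + x) (g + y))"
    by (simp add: o_def case_prod_beta)
  then show ?thesis
    unfolding RP_def mem_Collect_eq add.assoc[symmetric]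
    using RP_D(1,2,5)[OF assms] RP_D(3)[OF assms] RP_D(4)[OF assms] by blast
qed

text \<open>The covers for the radii \<open>1 / Suc n\<close> together still have at most
  \<open>r\<close> points because \<open>r\<close> is infinite. The index set \<open>Field r\<close>
  is the same for every \<open>\<Delta>\<close>.\<close>

lemma RP_dense_enumeration:
  fixes r :: "'k rel" and \<Delta> :: "'a::topological_group_add \<Rightarrow> 'a \<Rightarrow> real"
  assumes r: "Card_order r" "infinite (Field r)" "kappa_bounded TYPE('a) r" and \<Delta>: "\<Delta> \<in> RP"
  shows "\<exists>e :: 'k \<Rightarrow> 'a. \<forall>y. \<forall>\<epsilon>>0. \<exists>k\<in>Field r. \<Delta> y (e k) < \<epsilon>"
proof -
  have "\<exists>A. |A| \<le>o r \<and> {x. \<Delta> 0 x < 1 / Suc n} + A = UNIV" for n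
  proof -
    have "continuous_on UNIV ((\<lambda>(x, y). \<Delta> x y) \<circ> (\<lambda>x. (0, x)))"
      by (intro continuous_on_compose continuous_on_subset[OF RP_D(6)[OF \<Delta>]] continuous_intros) auto
    then have "open {x. \<Delta> 0 x < 1 / Suc n}"
      by (intro open_Collect_less) (auto simp: o_def)
    then have "0 \<in> interior {x. \<Delta> 0 x < 1 / Suc n}"
      by (simp add: interior_open RP_D(1)[OF \<Delta>])
    then show ?thesis
      using r(3) unfolding kappa_bounded_def by blast
  qed
  then obtain A where A: "\<And>n. |A n| \<le>o r" "\<And>n. {x. \<Delta> 0 x < 1 / Suc n} + A n = UNIV"
    by metis
  have rF: "r =o |Field r|"
    using r(1) card_of_Field_ordIso ordIso_symmetric by blast
  have leq: "|\<Union>n. A n| \<le>o |Field r|"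
    using r(2) A(1) rF ordLeq_ordIso_trans
    by (intro card_of_UNION_ordLeq_infinite) (auto simp flip: infinite_iff_card_of_nat)
  \<comment> \<open>A surjection from \<open>Field r\<close> exists only onto a nonempty
    set.\<close>
  have "(\<Union>n. A n) \<noteq> {}"
  proof
    assume "(\<Union>n. A n) = {}"
    then have "A 0 = {}" by blast
    then show False
      using A(2)[of 0] by (auto simp: set_plus_def)
  qed
  then have "\<exists>e. e ` Field r = (\<Union>n. A n)"
    using iffD2[OF card_of_ordLeq2 leq] by blast
  then obtain e where e: "e ` Field r = (\<Union>n. A n)" ..
  have "\<exists>k\<in>Field r. \<Delta> y (e k) < \<epsilon>" if \<epsilon>: "\<epsilon> > 0" for y \<epsilon>
  proof -
    obtain n where n: "1 / Suc n < \<epsilon>"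
      by (rule nat_approx_posE[OF \<epsilon>])
    obtain u a where ua: "\<Delta> 0 u < 1 / Suc n" "a \<in> A n" "y = u + a"
    proof -
      have "y \<in> {x. \<Delta> 0 x < 1 / Suc n} + A n"
        unfolding A(2) by (rule UNIV_I)
      then show ?thesis
        by (elim set_plus_elim) (auto intro: that)
    qed
    then have "a \<in> e ` Field r"
      unfolding e by blast
    then obtain k where "k \<in> Field r" "e k = a"
      by blast
    moreover have "\<Delta> y a = \<Delta> 0 u"
      using RP_D(5)[OF \<Delta>, of u a 0] RP_D(3)[OF \<Delta>] ua(3) by simp
    ultimately show ?thesis
      using ua n by (metis order_less_trans)
  qed
  then show ?thesis by blast
qed

text \<open>Transfinite recursion along \<open>|J|\<close>. If no translate were possible at some
  stage, finitely many conjugates of the ball of radius 1/2, each with fewer than \<open>r\<close>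
  translates, would cover the group. Then one conjugate would suffice up to differences, and
  differences of this ball lie in \<open>unit_ball \<Delta>\<close>, against the bound on
  \<open>eta_sharp\<close>.\<close>

lemma separated_translates:
  fixes r :: "'k rel" and \<Delta> :: "'a::topological_group_add \<Rightarrow> 'a \<Rightarrow> real" and e :: "'d \<Rightarrow> 'a"
  assumes r: "Card_order r" "infinite (Field r)" "r \<le>o eta_sharp \<Delta>" and \<Delta>: "\<Delta> \<in> RP"
  assumes J: "|J| \<le>o r" "\<And>j. j \<in> J \<Longrightarrow> finite (E j)"
  shows "\<exists>x :: 'j \<Rightarrow> 'a. \<forall>i\<in>J. \<forall>j\<in>J. i \<noteq> j \<longrightarrow>
    (\<forall>c\<in>E i. \<forall>d\<in>E j. 1 / 2 \<le> \<Delta> (e c + x i) (e d + x j))"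
proof -
  \<comment> \<open>The recursion runs over the whole index type; the guard makes the condition
    vacuous outside \<open>J\<close>.\<close>
  define P where "P f j y \<longleftrightarrow> j \<in> J \<longrightarrow> (\<forall>i\<in>underS ( |J| ) j. \<forall>c\<in>E i. \<forall>d\<in>E j.
    1 / 2 \<le> \<Delta> (e c + f i) (e d + y))" for f j y
  have wf: "wf ( |J| - Id)"
    using card_of_Well_order[of J] by (simp add: well_order_on_def)
  have "\<exists>y. P f j y" for f j
  proof (rule ccontr)
    assume "\<nexists>y. P f j y"
    then have j: "j \<in> J" and
      bad: "\<And>y. \<exists>i\<in>underS ( |J| ) j. \<exists>c\<in>E i. \<exists>d\<in>E j. \<Delta> (e c + f i) (e d + y) < 1 / 2"
      by (auto simp: P_def not_le)
    \<comment> \<open>The points placed before stage \<open>j\<close>. Initial segments of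
      \<open>|J|\<close> are smaller than \<open>|J|\<close>, and each contributes finitely many
      points, so \<open>U\<close> is smaller than \<open>r\<close>.\<close>
    define U where "U = (\<Union>i\<in>underS ( |J| ) j. (\<lambda>c. e c + f i) ` E i)"
    have "underS ( |J| ) j \<subseteq> J"
      using underS_Field[of _ "|J|" j] by (auto simp: Field_card_of)
    then have "|U| <o r"
      unfolding U_def using card_of_underS[OF card_of_Card_order[of J], of j] J j
      by (intro card_of_UNION_finite_ordLess[OF r(1,2)])
        (auto simp: Field_card_of intro: ordLess_ordLeq_trans)
    then have A: "|(\<lambda>u. - e d + u) ` U| <o r" for d
      using card_of_image ordLeq_ordLess_trans by blast
    have "\<exists>d\<in>E j. y \<in> (\<lambda>x. - e d + x + e d) ` {x. \<Delta> 0 x < 1 / 2} + (\<lambda>u. - e d + u) ` U" for y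
    proof -
      obtain u d where ud: "u \<in> U" "d \<in> E j" "\<Delta> u (e d + y) < 1 / 2"
        using bad[of y] unfolding U_def by blast
      have "\<Delta> 0 (e d + y - u) < 1 / 2"
        using ud(3) RP_D(5)[OF \<Delta>, of u "- u" "e d + y"] by simp
      moreover have "y = (- e d + (e d + y - u) + e d) + (- e d + u)"
        by (simp add: add.assoc)
      ultimately show ?thesis
        using ud by (intro bexI[of _ d], subst \<open>y = _\<close>) (intro set_plus_intro imageI CollectI)
    qed
    then have "(\<Union>d\<in>E j. (\<lambda>x. - e d + x + e d) ` {x. \<Delta> 0 x < 1 / 2} + (\<lambda>u. - e d + u) ` U) = UNIV"
      by blast
    from finite_cover_by_translates[OF r(1,2) J(2)[OF j] A this]
    obtain d C where C: "|C| <o r"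
      "\<forall>y. \<exists>b\<in>(\<lambda>x. - e d + x + e d) ` {x. \<Delta> 0 x < 1 / 2}.
        \<exists>b'\<in>(\<lambda>x. - e d + x + e d) ` {x. \<Delta> 0 x < 1 / 2}. \<exists>c\<in>C. y = - b + b' + c"
      by (elim bexE exE conjE)
    \<comment> \<open>Translating by \<open>e d\<close> on the left undoes the conjugation and
      leaves \<open>- b + b'\<close> with both terms in the ball of radius 1/2.\<close>
    have "y \<in> unit_ball \<Delta> + (\<lambda>c. e d + c) ` C" for y
    proof -
      obtain b b' c where b: "\<Delta> 0 b < 1 / 2" "\<Delta> 0 b' < 1 / 2" "c \<in> C"
        "- e d + y = - (- e d + b + e d) + (- e d + b' + e d) + c"
        using C(2)[THEN spec, of "- e d + y"] by (elim bexE imageE CollectE) simp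
      have "e d + (- e d + y) = - b + b' + (e d + c)"
        unfolding b(4) by (simp add: minus_add add.assoc del: add_uminus_conv_diff)
      then have y: "y = (- b + b') + (e d + c)"
        by (simp only: add_minus_cancel)
      have "\<Delta> 0 (- b + b') \<le> \<Delta> 0 b' + \<Delta> b' (- b + b')"
        by (rule RP_D(4)[OF \<Delta>])
      also have "\<Delta> b' (- b + b') = \<Delta> 0 b"
        using RP_D(5)[OF \<Delta>, of 0 b' "- b"] RP_D(5)[OF \<Delta>, of 0 b "- b"] RP_D(3)[OF \<Delta>] by simp
      finally have "- b + b' \<in> unit_ball \<Delta>"
        using b by (simp add: unit_ball_def)
      then show ?thesis
        unfolding y using b(3) by (intro set_plus_intro) auto
    qed
    then have "unit_ball \<Delta> + (\<lambda>c. e d + c) ` C = UNIV"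
      by blast
    then have "r \<le>o |(\<lambda>c. e d + c) ` C|"
      using eta_sharp_least(3)[OF \<Delta>] r(3) ordLeq_transitive by blast
    then have "r \<le>o |C|"
      using card_of_image ordLeq_transitive by blast
    then show False
      using C(1) not_ordLess_ordLeq by blast
  qed
  \<comment> \<open>The recursion principle requires that stage \<open>j\<close> read
    \<open>f\<close> only at earlier stages.\<close>
  moreover have "P f j y = P g j y" if "\<And>i. (i, j) \<in> |J| - Id \<Longrightarrow> f i = g i" for f g j y
  proof -
    have "f i = g i" if "i \<in> underS ( |J| ) j" for i
      using that \<open>\<And>i. (i, j) \<in> |J| - Id \<Longrightarrow> f i = g i\<close> by (auto simp: underS_def)
    then show ?thesis
      unfolding P_def by simp
  qed
  ultimately obtain x where x: "\<And>j. P x j (x j)"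
    using dependent_wf_choice[OF wf, of P] by blast
  have "1 / 2 \<le> \<Delta> (e c + x i) (e d + x j)"
    if ij: "i \<in> J" "j \<in> J" "i \<noteq> j" "c \<in> E i" "d \<in> E j" for i j c d
  proof -
    have "i \<in> underS ( |J| ) j \<or> j \<in> underS ( |J| ) i"
      using card_of_well_order_on[of J] ij(1-3)
      unfolding well_order_on_def linear_order_on_def total_on_def underS_def by blast
    then show ?thesis
      using x[of i] x[of j] ij RP_D(3)[OF \<Delta>] unfolding P_def by metis
  qed
  then show ?thesis by blast
qed

section \<open>Functionals on LUC\<close>

lemma LUC_iff:
  "f \<in> LUC \<longleftrightarrow> bounded (range f) \<and>
    (\<forall>\<epsilon>>0. eventually (\<lambda>(x, y). dist (f x) (f y) < \<epsilon>) RP_uniformity)"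
proof -
  have "(LIM (x, y) RP_uniformity. (f x, f y) :> uniformity) \<longleftrightarrow>
      (\<forall>\<epsilon>>0. eventually (\<lambda>(x, y). dist (f x) (f y) < \<epsilon>) RP_uniformity)" (is "?L \<longleftrightarrow> ?R")
  proof
    assume L: ?L
    show ?R
    proof (intro allI impI)
      fix \<epsilon> :: real assume "\<epsilon> > 0"
      then have "eventually (\<lambda>(a, b). dist a b < \<epsilon>) (uniformity :: (complex \<times> complex) filter)"
        unfolding eventually_uniformity_metric by blast
      then show "eventually (\<lambda>(x, y). dist (f x) (f y) < \<epsilon>) RP_uniformity"
        using L[unfolded filterlim_iff, rule_format] by (fastforce elim: eventually_mono)
    qed
  next
    assume R: ?R
    show ?L
      unfolding filterlim_iff
    proof (intro allI impI)
      fix P :: "complex \<times> complex \<Rightarrow> bool" assume "eventually P uniformity"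
      then obtain \<epsilon> where \<epsilon>: "\<epsilon> > 0" "\<And>a b. dist a b < \<epsilon> \<Longrightarrow> P (a, b)"
        unfolding eventually_uniformity_metric by blast
      show "eventually (\<lambda>p. P (case p of (x, y) \<Rightarrow> (f x, f y))) RP_uniformity"
        using R[rule_format, OF \<epsilon>(1)] by eventually_elim (auto intro: \<epsilon>(2))
    qed
  qed
  then show ?thesis
    by (simp add: LUC_def)
qed

lemma eventually_RP_uniformity:
  assumes "\<Delta> \<in> RP" "0 < \<epsilon>"
  shows "eventually (\<lambda>(x, y). \<Delta> x y < \<epsilon>) RP_uniformity"
proof -
  have "RP_uniformity \<le> principal {(x, y). \<Delta> x y < \<epsilon>}"
    unfolding RP_uniformity_def using assms by (intro INF_lower2[of \<Delta>] INF_lower2[of \<epsilon>]) auto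
  then show ?thesis
    unfolding le_principal by simp
qed

lemma LUC_add:
  assumes "f \<in> LUC" "g \<in> LUC"
  shows "(\<lambda>x. f x + g x) \<in> LUC"
  unfolding LUC_iff
proof (intro conjI allI impI)
  show "bounded (range (\<lambda>x. f x + g x))"
    using assms by (intro bounded_plus_comp) (auto simp: LUC_iff)
  fix \<epsilon> :: real assume "\<epsilon> > 0"
  then have "eventually (\<lambda>(x, y). dist (f x) (f y) < \<epsilon> / 2) RP_uniformity"
    "eventually (\<lambda>(x, y). dist (g x) (g y) < \<epsilon> / 2) RP_uniformity"
    using assms unfolding LUC_iff by (meson half_gt_zero)+
  then show "eventually (\<lambda>(x, y). dist (f x + g x) (f y + g y) < \<epsilon>) RP_uniformity"
  proof eventually_elim
    case (elim p)
    then show ?case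
      using dist_triangle_add[of "f (fst p)" "g (fst p)" "f (snd p)" "g (snd p)"]
      by (auto simp: case_prod_beta)
  qed
qed

lemma LUC_cmult:
  assumes "f \<in> LUC"
  shows "(\<lambda>x. c * f x) \<in> LUC"
  unfolding LUC_iff
proof (intro conjI allI impI)
  have "bounded ((*) c ` range f)"
    using assms by (intro bounded_linear_image bounded_linear_mult_right) (simp add: LUC_iff)
  then show "bounded (range (\<lambda>x. c * f x))"
    by (simp add: image_image)
  fix \<epsilon> :: real assume "\<epsilon> > 0"
  then have "\<epsilon> / (cmod c + 1) > 0"
    by (intro divide_pos_pos) (auto simp: add_nonneg_pos)
  then have "eventually (\<lambda>(x, y). dist (f x) (f y) < \<epsilon> / (cmod c + 1)) RP_uniformity"
    using assms unfolding LUC_iff by meson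
  then show "eventually (\<lambda>(x, y). dist (c * f x) (c * f y) < \<epsilon>) RP_uniformity"
  proof eventually_elim
    case (elim p)
    obtain x y where p: "p = (x, y)" by fastforce
    have "cmod c + 1 > 0"
      by (simp add: add_nonneg_pos)
    then have "dist (f x) (f y) * (cmod c + 1) < \<epsilon>"
      using elim by (simp add: p pos_less_divide_eq)
    moreover have "dist (c * f x) (c * f y) = cmod c * dist (f x) (f y)"
      by (simp add: dist_norm flip: norm_mult right_diff_distrib)
    moreover have "dist (f x) (f y) * (cmod c + 1) = cmod c * dist (f x) (f y) + dist (f x) (f y)"
      by (simp add: algebra_simps)
    ultimately show ?case
      using zero_le_dist[of "f x" "f y"] unfolding p split_conv by linarith
  qed
qed

text \<open>The translate obeys the same bound for the left-translated pseudometrics, which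
  \<open>RP_ltrans\<close> keeps in \<open>RP\<close>. The constant 8 is the one that the
  interpolation below produces.\<close>

lemma ltrans_in_LUC:
  assumes \<Delta>: "\<Delta> \<in> RP" "\<Delta>' \<in> RP" and "\<And>z. u z \<in> {0..1}"
    and u: "\<And>z w. \<bar>u z - u w\<bar> \<le> \<Delta> z w + 8 * \<Delta>' z w"
  shows "ltrans g (\<lambda>z. complex_of_real (u z)) \<in> LUC"
  unfolding LUC_iff ltrans_def
proof (intro conjI allI impI)
  show "bounded (range (\<lambda>y. complex_of_real (u (g + y))))"
    using assms(3) by (intro boundedI[where B = 1]) auto
  fix \<epsilon> :: real assume "\<epsilon> > 0"
  then have "eventually (\<lambda>(x, y). \<Delta> (g + x) (g + y) < \<epsilon> / 2) RP_uniformity"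
    "eventually (\<lambda>(x, y). \<Delta>' (g + x) (g + y) < \<epsilon> / 16) RP_uniformity"
    by (intro eventually_RP_uniformity RP_ltrans \<Delta>; simp)+
  then show "eventually (\<lambda>(x, y). dist (complex_of_real (u (g + x))) (complex_of_real (u (g + y))) < \<epsilon>)
      RP_uniformity"
  proof eventually_elim
    case (elim p)
    then show ?case
      using u[of "g + fst p" "g + snd p"]
      by (auto simp: case_prod_beta dist_norm simp flip: of_real_diff)
  qed
qed

lemma cmod_le_sup_norm: "bounded (range f) \<Longrightarrow> cmod (f x) \<le> sup_norm f"
  unfolding sup_norm_def by (rule cSUP_upper) (auto simp: bounded_iff bdd_above_def)

lemma limitin_weak_star_iff:
  "limitin weak_star N \<nu> F \<longleftrightarrow> \<nu> \<in> LUC_dual \<and> (\<forall>\<^sub>F a in F. N a \<in> LUC_dual) \<and>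
    (\<forall>h\<in>LUC. ((\<lambda>a. N a h) \<longlongrightarrow> \<nu> h) F)"
proof -
  have ext: "LUC_dual \<subseteq> extensional LUC"
    by (auto simp: LUC_dual_def)
  show ?thesis
    unfolding weak_star_def limitin_subtopology limitin_componentwise
    using ext by (auto simp: PiE_def elim!: eventually_mono)
qed

lemma topspace_weak_star: "topspace weak_star = LUC_dual"
  by (auto simp: weak_star_def LUC_dual_def PiE_def)

text \<open>The closed unit ball of the dual, whose uniform bound provides compactness.\<close>

definition dual_ball :: "(('a::topological_group_add \<Rightarrow> complex) \<Rightarrow> complex) set" where
  "dual_ball = {\<nu> \<in> LUC_dual. \<forall>f\<in>LUC. cmod (\<nu> f) \<le> sup_norm f}"

lemma point_eval_in_dual_ball: "point_eval x \<in> dual_ball"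
proof -
  have "cmod (point_eval x f) \<le> 1 * sup_norm f" if "f \<in> LUC" for f
    using that by (auto simp: point_eval_def LUC_iff intro: cmod_le_sup_norm)
  then show ?thesis
    unfolding dual_ball_def LUC_dual_def
    by (auto simp: point_eval_def LUC_add LUC_cmult intro!: exI[of _ 1])
qed

lemma point_eval_in_G_LUC: "point_eval x \<in> G_LUC"
proof -
  have "range point_eval \<subseteq> topspace weak_star"
    using point_eval_in_dual_ball by (auto simp: topspace_weak_star dual_ball_def)
  from closure_of_subset[OF this] show ?thesis
    unfolding G_LUC_def by blast
qed

text \<open>The Banach-Alaoglu argument: Tychonoff's theorem for a product of discs gives a cluster
  point, and linearity passes to the limit along the finer filter \<open>H\<close>.\<close>

lemma dual_ball_cluster_point:
  fixes N :: "'i \<Rightarrow> ('a::topological_group_add \<Rightarrow> complex) \<Rightarrow> complex"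
  assumes "Q \<noteq> bot" "\<And>i. N i \<in> dual_ball" "\<And>i. N i \<in> G_LUC"
  shows "\<exists>\<nu>\<in>dual_ball \<inter> G_LUC. \<exists>H. H \<noteq> bot \<and> H \<le> filtermap N Q \<and> limitin weak_star (\<lambda>t. t) \<nu> H"
proof -
  \<comment> \<open>The one-point factor outside \<open>LUC\<close> forces the limit to be
    extensional.\<close>
  define C where "C f = (if f \<in> LUC then cball 0 (sup_norm f) else {undefined :: complex})"
    for f :: "'a \<Rightarrow> complex"
  have "compactin (product_topology (\<lambda>_. euclidean) UNIV) (PiE UNIV C)"
    by (subst compactin_PiE) (auto simp: C_def)
  then have "compact (PiE UNIV C)"
    by (simp add: euclidean_product_topology)
  moreover have "\<forall>\<^sub>F t in filtermap N Q. t \<in> PiE UNIV C"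
    using assms(2) unfolding eventually_filtermap
    by (intro always_eventually) (auto simp: C_def dual_ball_def LUC_dual_def extensional_def)
  moreover have "filtermap N Q \<noteq> bot"
    using assms(1) by (simp add: filtermap_bot_iff)
  ultimately obtain \<nu> where \<nu>: "\<nu> \<in> PiE UNIV C" "inf (nhds \<nu>) (filtermap N Q) \<noteq> bot"
    unfolding compact_filter by blast
  define H where "H = inf (nhds \<nu>) (filtermap N Q)"
  have H: "H \<noteq> bot" "H \<le> filtermap N Q"
    using \<nu> by (auto simp: H_def)
  have ev: "eventually P H" if "\<And>i. P (N i)" for P
    using that by (intro filter_leD[OF H(2)]) (simp add: eventually_filtermap)
  have lim: "((\<lambda>t. t h) \<longlongrightarrow> \<nu> h) H" for h
  proof -
    have "((\<lambda>t. t h) \<longlongrightarrow> \<nu> h) (nhds \<nu>)"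
      using continuous_on_product_coordinates[of h] tendsto_at_iff_tendsto_nhds[of "\<lambda>t. t h" \<nu>]
      unfolding continuous_on_def by blast
    then show ?thesis
      by (rule tendsto_mono[rotated]) (simp add: H_def)
  qed
  have N: "N i \<in> LUC_dual" for i
    using assms(2) by (auto simp: dual_ball_def)
  have N_add: "N i (\<lambda>x. f x + g x) = N i f + N i g" if "f \<in> LUC" "g \<in> LUC" for i f g
    using N[of i] that unfolding LUC_dual_def by blast
  have N_cmult: "N i (\<lambda>x. c * f x) = c * N i f" if "f \<in> LUC" for i c f
    using N[of i] that unfolding LUC_dual_def by blast
  have le: "cmod (\<nu> f) \<le> sup_norm f" if "f \<in> LUC" for f
    using PiE_mem[OF \<nu>(1), of f] that by (simp add: C_def)
  have "\<nu> \<in> LUC_dual"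
    unfolding LUC_dual_def
  proof (intro CollectI conjI ballI allI)
    show "\<nu> \<in> extensional LUC"
      unfolding extensional_def
    proof (intro CollectI allI impI)
      show "\<nu> f = undefined" if "f \<notin> LUC" for f
        using PiE_mem[OF \<nu>(1), of f] that by (simp add: C_def)
    qed
    show "\<nu> (\<lambda>x. f x + g x) = \<nu> f + \<nu> g" if "f \<in> LUC" "g \<in> LUC" for f g
    proof (rule tendsto_unique[OF H(1) lim])
      show "((\<lambda>t. t (\<lambda>x. f x + g x)) \<longlongrightarrow> \<nu> f + \<nu> g) H"
        by (rule Lim_transform_eventually[OF tendsto_add[OF lim[of f] lim[of g]]], rule ev)
          (rule N_add[OF that, symmetric])
    qed
    show "\<nu> (\<lambda>x. c * f x) = c * \<nu> f" if "f \<in> LUC" for c f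
    proof (rule tendsto_unique[OF H(1) lim])
      show "((\<lambda>t. t (\<lambda>x. c * f x)) \<longlongrightarrow> c * \<nu> f) H"
        by (rule Lim_transform_eventually[OF tendsto_mult_left[OF lim[of f]]], rule ev)
          (rule N_cmult[OF that, symmetric])
    qed
    show "\<exists>K. \<forall>f\<in>LUC. cmod (\<nu> f) \<le> K * sup_norm f"
      using le by (intro exI[of _ 1]) simp
  qed
  moreover from this have "limitin weak_star (\<lambda>t. t) \<nu> H"
    unfolding limitin_weak_star_iff by (intro conjI ballI lim ev N)
  moreover from this have "\<nu> \<in> G_LUC"
  proof (rule limitin_closedin)
    show "closedin weak_star G_LUC"
      by (simp add: G_LUC_def)
    show "\<forall>\<^sub>F t in H. t \<in> G_LUC"
      by (rule ev) (rule assms(3))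
  qed (rule H(1))
  ultimately show ?thesis
    using H le by (auto simp: dual_ball_def)
qed

text \<open>The cluster point is not unique, but it must agree with every limit that exists along
  \<open>Q\<close>; its values are computed through this property alone.\<close>

lemma G_LUC_cluster_point:
  fixes p :: "'i \<Rightarrow> 'a::topological_group_add"
  assumes "Q \<noteq> bot"
  shows "\<exists>\<nu>\<in>dual_ball \<inter> G_LUC. \<forall>h\<in>LUC. \<forall>c. ((\<lambda>i. h (p i)) \<longlongrightarrow> c) Q \<longrightarrow> \<nu> h = c"
proof -
  obtain \<nu> H where \<nu>: "\<nu> \<in> dual_ball \<inter> G_LUC" and H: "H \<noteq> bot"
    "H \<le> filtermap (\<lambda>i. point_eval (p i)) Q" "limitin weak_star (\<lambda>t. t) \<nu> H"
    using dual_ball_cluster_point[OF assms, of "\<lambda>i. point_eval (p i)"]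
      point_eval_in_dual_ball point_eval_in_G_LUC by blast
  have "\<nu> h = c" if h: "h \<in> LUC" and c: "((\<lambda>i. h (p i)) \<longlongrightarrow> c) Q" for h c
  proof (rule tendsto_unique[OF H(1)])
    show "((\<lambda>t. t h) \<longlongrightarrow> \<nu> h) H"
      using H(3) h by (simp add: limitin_weak_star_iff)
    have "((\<lambda>t. t h) \<longlongrightarrow> c) (filtermap (\<lambda>i. point_eval (p i)) Q)"
      using c h by (simp add: filterlim_filtermap point_eval_def)
    then show "((\<lambda>t. t h) \<longlongrightarrow> c) H"
      by (rule tendsto_mono[OF H(2)])
  qed
  then show ?thesis
    using \<nu> by blast
qed

text \<open>The conditions given by \<open>Z\<close> and \<open>\<delta>\<close> hold near
  \<open>f\<close> in the topology of pointwise convergence, so a pair without such a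
  \<open>g\<close> would keep \<open>\<mu>\<close> within \<open>\<epsilon>\<close> of
  \<open>\<mu> f\<close> there.\<close>

lemma not_uniform_measureD:
  assumes "\<mu> \<in> LUC_dual" "\<mu> \<notin> uniform_measures"
  shows "\<exists>\<Delta>\<in>RP. \<exists>f\<in>BLip \<Delta>. \<exists>\<epsilon>>0. \<forall>Z \<delta>. finite Z \<longrightarrow> \<delta> > 0 \<longrightarrow>
    (\<exists>g\<in>BLip \<Delta>. (\<forall>z\<in>Z. dist (g z) (f z) < \<delta>) \<and> \<epsilon> \<le> dist (\<mu> g) (\<mu> f))"
proof -
  obtain \<Delta> where \<Delta>: "\<Delta> \<in> RP" "\<not> continuous_on (BLip \<Delta>) \<mu>"
    using assms by (auto simp: uniform_measures_def)
  then obtain f where f: "f \<in> BLip \<Delta>" "\<not> (\<mu> \<longlongrightarrow> \<mu> f) (at f within BLip \<Delta>)"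
    unfolding continuous_on_def by blast
  then obtain \<epsilon> where \<epsilon>: "\<epsilon> > 0"
    "\<not> (\<forall>\<^sub>F g in at f within BLip \<Delta>. dist (\<mu> g) (\<mu> f) < \<epsilon>)"
    unfolding tendsto_iff by blast
  have "\<exists>g\<in>BLip \<Delta>. (\<forall>z\<in>Z. dist (g z) (f z) < \<delta>) \<and> \<epsilon> \<le> dist (\<mu> g) (\<mu> f)"
    if Z: "finite Z" and \<delta>: "\<delta> > 0" for Z \<delta>
  proof (rule ccontr)
    assume no: "\<not> ?thesis"
    have "((\<lambda>t. t z) \<longlongrightarrow> f z) (at f)" for z
      using continuous_on_product_coordinates[of z] unfolding continuous_on_def by blast
    then have "\<forall>\<^sub>F g in at f. dist (g z) (f z) < \<delta>" for z
      using \<delta> unfolding tendsto_iff by blast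
    then have "\<forall>\<^sub>F g in at f. \<forall>z\<in>Z. dist (g z) (f z) < \<delta>"
      using Z by (simp add: eventually_ball_finite)
    then have "\<forall>\<^sub>F g in at f within BLip \<Delta>. \<forall>z\<in>Z. dist (g z) (f z) < \<delta>"
      by (rule filter_leD[OF at_le, rotated]) simp
    moreover have "\<forall>\<^sub>F g in at f within BLip \<Delta>. g \<in> BLip \<Delta>"
      by (simp add: eventually_at_topological) auto
    ultimately have "\<forall>\<^sub>F g in at f within BLip \<Delta>. dist (\<mu> g) (\<mu> f) < \<epsilon>"
      by eventually_elim (use no in \<open>auto simp: not_le\<close>)
    then show False
      using \<epsilon>(2) by blast
  qed
  then show ?thesis
    using \<Delta>(1) f(1) \<epsilon>(1) by blast
qed

section \<open>Interpolation\<close>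

text \<open>A supremum of truncated pieces, one for each point \<open>e d + x j\<close>. All pieces
  share one Lipschitz bound, so the supremum keeps it, and separation keeps pieces of different
  indices apart.\<close>

lemma interpolate_on_separated_translates:
  fixes \<Delta> \<Delta>' :: "'a::topological_group_add \<Rightarrow> 'a \<Rightarrow> real"
  assumes \<Delta>: "\<Delta> \<in> RP" and \<Delta>': "\<Delta>' \<in> RP"
    and sep: "\<And>i j c d. i \<in> J \<Longrightarrow> j \<in> J \<Longrightarrow> i \<noteq> j \<Longrightarrow> c \<in> E i \<Longrightarrow> d \<in> E j \<Longrightarrow>
      1 / 2 \<le> \<Delta>' (e c + x i) (e d + x j)"
    and g01: "\<And>j y. j \<in> J \<Longrightarrow> g j y \<in> {0..1}"
    and glip: "\<And>j y z. j \<in> J \<Longrightarrow> \<bar>g j y - g j z\<bar> \<le> \<Delta> y z"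
  shows "\<exists>f. (\<forall>z. f z \<in> {0..1::real}) \<and> (\<forall>z w. \<bar>f z - f w\<bar> \<le> \<Delta> z w + 8 * \<Delta>' z w) \<and>
    (\<forall>j\<in>J. \<forall>d\<in>E j. \<forall>y. \<Delta>' y (e d) < 1 / 8 \<longrightarrow> f (y + x j) = g j y)"
proof -
  \<comment> \<open>The cutoff is at least 1 up to distance 1/8 and vanishes from 1/4 on. Taking the
    minimum makes pieces with equal index \<open>j\<close> agree or drop below the translate of
    \<open>g j\<close>, so they never conflict.\<close>
  define \<phi> where "\<phi> j d z = min (g j (z - x j)) (max 0 (2 - 8 * \<Delta>' z (e d + x j)))" for j d z
  \<comment> \<open>The element 0 keeps the set nonempty if there are no pieces, and makes the
    supremum nonnegative.\<close>
  define S where "S z = insert 0 ((\<lambda>(j, d). \<phi> j d z) ` Sigma J E)" for z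
  have \<phi>01: "0 \<le> \<phi> j d z" "\<phi> j d z \<le> 1" if "j \<in> J" for j d z
    using g01[OF that, of "z - x j"] by (auto simp: \<phi>_def)
  have bdd: "bdd_above (S z)" for z
    unfolding S_def by (intro bdd_aboveI[of _ 1]) (auto intro: \<phi>01)
  have upper: "0 \<le> Sup (S z)" "\<And>j d. j \<in> J \<Longrightarrow> d \<in> E j \<Longrightarrow> \<phi> j d z \<le> Sup (S z)" for z
    by (rule cSup_upper[OF _ bdd], force simp: S_def)+
  have least: "Sup (S z) \<le> b" if "0 \<le> b" "\<And>j d. j \<in> J \<Longrightarrow> d \<in> E j \<Longrightarrow> \<phi> j d z \<le> b" for z b
    by (rule cSup_least) (use that in \<open>auto simp: S_def\<close>)
  have lip: "\<phi> j d z \<le> \<phi> j d w + (\<Delta> z w + 8 * \<Delta>' z w)" if "j \<in> J" for j d z w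
  proof -
    have "\<Delta> (z - x j) (w - x j) = \<Delta> z w"
      using RP_D(5)[OF \<Delta>, of z "- x j" w] by simp
    then show ?thesis
      using glip[OF that, of "z - x j" "w - x j"] RP_abs_diff_le[OF \<Delta>', of z "e d + x j" w]
        RP_D(2)[OF \<Delta>, of z w] RP_D(2)[OF \<Delta>', of z w]
      unfolding \<phi>_def by linarith
  qed
  have le: "Sup (S z) \<le> Sup (S w) + (\<Delta> z w + 8 * \<Delta>' z w)" for z w
  proof (rule least)
    show "0 \<le> Sup (S w) + (\<Delta> z w + 8 * \<Delta>' z w)"
      using upper(1)[of w] RP_D(2)[OF \<Delta>, of z w] RP_D(2)[OF \<Delta>', of z w] by linarith
    show "\<phi> j d z \<le> Sup (S w) + (\<Delta> z w + 8 * \<Delta>' z w)" if "j \<in> J" "d \<in> E j" for j d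
      using lip[OF that(1), of d z w] upper(2)[OF that, of w] by linarith
  qed
  have "Sup (S (y + x j)) = g j y" if j: "j \<in> J" "d \<in> E j" and y: "\<Delta>' y (e d) < 1 / 8" for j d y
  proof (rule antisym)
    have d: "\<Delta>' (y + x j) (e d + x j) < 1 / 8"
      using y RP_D(5)[OF \<Delta>'] by simp
    then have "\<phi> j d (y + x j) = g j y"
      using g01[OF j(1), of y] by (auto simp: \<phi>_def)
    then show "g j y \<le> Sup (S (y + x j))"
      using upper(2)[OF j, of "y + x j"] by simp
    show "Sup (S (y + x j)) \<le> g j y"
    proof (rule least)
      show "0 \<le> g j y"
        using g01[OF j(1), of y] by simp
      show "\<phi> i c (y + x j) \<le> g j y" if i: "i \<in> J" "c \<in> E i" for i c
      proof (cases "i = j")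
        case True
        then show ?thesis
          by (simp add: \<phi>_def)
      next
        case False
        have "1 / 2 \<le> \<Delta>' (e c + x i) (y + x j) + \<Delta>' (y + x j) (e d + x j)"
          using sep[OF i(1) j(1) False i(2) j(2)] RP_D(4)[OF \<Delta>'] order_trans by blast
        then have "2 - 8 * \<Delta>' (y + x j) (e c + x i) \<le> 0"
          using d RP_D(3)[OF \<Delta>', of "y + x j"] by simp
        then show ?thesis
          using \<open>0 \<le> g j y\<close> by (simp add: \<phi>_def)
      qed
    qed
  qed
  moreover have "Sup (S z) \<in> {0..1}" for z
    using upper(1) least[of 1] \<phi>01 by simp
  moreover have "\<bar>Sup (S z) - Sup (S w)\<bar> \<le> \<Delta> z w + 8 * \<Delta>' z w" for z w
    using le[of z w] le[of w z] RP_D(3)[OF \<Delta>, of z w] RP_D(3)[OF \<Delta>', of z w] by linarith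
  ultimately show ?thesis
    by (intro exI[of _ "\<lambda>z. Sup (S z)"]) blast
qed

section \<open>The determining net\<close>

theorem theorem3p2:
  assumes "\<exists>\<Delta>\<^sub>0 \<in> (RP :: ('a::{topological_group_add, t2_space} \<Rightarrow> 'a \<Rightarrow> real) set).
      eta_sharp \<Delta>\<^sub>0 =o (bounding_cardinal :: (nat + 'a) rel)"
  shows "\<exists>\<nu> \<in> G_LUC - range (point_eval :: 'a \<Rightarrow> ('a \<Rightarrow> complex) \<Rightarrow> complex).
    \<exists>(\<Gamma> :: (('a \<Rightarrow> complex) \<Rightarrow> complex) net_index set) le N.
      directed \<Gamma> le \<and>
      (\<forall>\<gamma>\<in>\<Gamma>. N \<gamma> \<in> G_LUC - range point_eval) \<and>
      limitin (subtopology weak_star G_LUC) N \<nu> (along \<Gamma> le) \<and>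
      (\<forall>\<mu> \<in> LUC_dual.
        limitin weak_star (\<lambda>\<gamma>. \<mu> \<star> N \<gamma>) (\<mu> \<star> \<nu>) (along \<Gamma> le) \<longrightarrow> \<mu> \<in> uniform_measures)"
proof -

  \<comment> \<open>The common index set and the separated translates\<close>
  obtain \<Delta>\<^sub>0 :: "'a \<Rightarrow> 'a \<Rightarrow> real" where \<Delta>\<^sub>0: "\<Delta>\<^sub>0 \<in> RP"
    and eta: "eta_sharp \<Delta>\<^sub>0 =o (bounding_cardinal :: (nat + 'a) rel)"
    using assms by blast
  let ?r = "bounding_cardinal :: (nat + 'a) rel"
  note r = bounding_cardinal_least(1-3)[where 'a = 'a]
  define K where "K = Field ?r"
  have K: "infinite K"
    using r(2) by (simp add: K_def)
  then obtain k\<^sub>0 where k\<^sub>0: "k\<^sub>0 \<in> K"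
    using infinite_imp_nonempty by blast
  define Q where "Q = finite_subsets_at_top K"
  have Q: "Q \<noteq> bot"
    by (simp add: Q_def)
  have Q_ev: "\<forall>\<^sub>F E in Q. finite E \<and> E \<subseteq> K \<and> X \<subseteq> E" if "finite X" "X \<subseteq> K" for X
    using that unfolding Q_def eventually_finite_subsets_at_top by blast
  obtain e where e: "\<And>y \<epsilon>. \<epsilon> > 0 \<Longrightarrow> \<exists>k\<in>K. \<Delta>\<^sub>0 y (e k) < \<epsilon>"
    using RP_dense_enumeration[OF r \<Delta>\<^sub>0] unfolding K_def by blast
  define J where "J = Fpow K \<times> Fpow K"
  have "|J| \<le>o |K|"
    unfolding J_def using card_of_Fpow_ordLeq_infinite[OF K]
    by (intro card_of_Sigma_ordLeq_infinite[OF K]) auto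
  then have J: "|J| \<le>o ?r"
    unfolding K_def using card_of_Field_ordIso[OF r(1)] ordLeq_ordIso_trans by blast
  have "finite (fst j)" if "j \<in> J" for j
    using that by (auto simp: J_def Fpow_def)
  note sep = separated_translates[OF r(1,2) ordIso_imp_ordLeq[OF ordIso_symmetric[OF eta]] \<Delta>\<^sub>0 J this, of "\<lambda>j. j" e]
  obtain x where x: "\<And>i j c d. i \<in> J \<Longrightarrow> j \<in> J \<Longrightarrow> i \<noteq> j \<Longrightarrow> c \<in> fst i \<Longrightarrow> d \<in> fst j \<Longrightarrow>
      1 / 2 \<le> \<Delta>\<^sub>0 (e c + x i) (e d + x j)"
    using sep by blast

  \<comment> \<open>Iterated cluster points, first over \<open>E\<close>, then over
    \<open>F\<close>\<close>
  have "\<forall>F. \<exists>t\<in>dual_ball \<inter> G_LUC. \<forall>h\<in>LUC. \<forall>c. ((\<lambda>E. h (x (E, F))) \<longlongrightarrow> c) Q \<longrightarrow> t h = c"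
    by (rule allI) (rule G_LUC_cluster_point[OF Q])
  then obtain \<nu>F where \<nu>F: "\<And>F. \<nu>F F \<in> dual_ball" "\<And>F. \<nu>F F \<in> G_LUC"
    "\<And>F h c. h \<in> LUC \<Longrightarrow> ((\<lambda>E. h (x (E, F))) \<longlongrightarrow> c) Q \<Longrightarrow> \<nu>F F h = c"
    by (metis IntD1 IntD2)
  obtain \<nu> H where \<nu>: "\<nu> \<in> G_LUC" and H: "H \<noteq> bot" "H \<le> filtermap \<nu>F Q"
    and lim: "limitin weak_star (\<lambda>t. t) \<nu> H"
    using dual_ball_cluster_point[OF Q, of \<nu>F] \<nu>F by blast
  have \<nu>_eq: "\<nu> h = c" if "h \<in> LUC" "((\<lambda>F. \<nu>F F h) \<longlongrightarrow> c) Q" for h c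
  proof (rule tendsto_unique[OF H(1)])
    show "((\<lambda>t. t h) \<longlongrightarrow> \<nu> h) H"
      using lim that by (simp add: limitin_weak_star_iff)
    have "((\<lambda>t. t h) \<longlongrightarrow> c) (filtermap \<nu>F Q)"
      using that by (simp add: filterlim_filtermap)
    then show "((\<lambda>t. t h) \<longlongrightarrow> c) H"
      by (rule tendsto_mono[OF H(2)])
  qed

  \<comment> \<open>The test functions \<open>bt p\<close> vanish at all \<open>\<nu>F F\<close>, but not at the point evaluation at \<open>p\<close>.\<close>
  define b where "b p z = max 0 (1 - 4 * \<Delta>\<^sub>0 z (e k\<^sub>0 + p))" for p z
  \<comment> \<open>Separation concerns the points \<open>e c + x j\<close> rather than
    \<open>x j\<close> itself, hence the translate by \<open>e k\<^sub>0\<close>.\<close>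
  define bt where "bt p = ltrans (e k\<^sub>0) (\<lambda>z. complex_of_real (b p z))" for p
  have bt_LUC: "bt p \<in> LUC" for p
    unfolding bt_def
  proof (rule ltrans_in_LUC[OF \<Delta>\<^sub>0 \<Delta>\<^sub>0])
    show "b p z \<in> {0..1}" for z
      using RP_D(2)[OF \<Delta>\<^sub>0] by (auto simp: b_def)
    show "\<bar>b p z - b p w\<bar> \<le> \<Delta>\<^sub>0 z w + 8 * \<Delta>\<^sub>0 z w" for z w
      using RP_abs_diff_le[OF \<Delta>\<^sub>0, of z "e k\<^sub>0 + p" w] RP_D(2)[OF \<Delta>\<^sub>0, of z w]
      unfolding b_def by linarith
  qed
  have bt_\<nu>F: "\<nu>F F (bt p) = 0" if F: "F \<in> Fpow K" for F p
  proof (rule \<nu>F(3)[OF bt_LUC])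
    \<comment> \<open>Two of these points within 1/4 of \<open>e k\<^sub>0 + p\<close> would be
      closer than 1/2 to each other. So at most one \<open>E\<close> containing
      \<open>k\<^sub>0\<close> gives a nonzero value, and an index \<open>k\<close> outside it
      excludes it eventually.\<close>
    have small: "E = E'" if "finite E" "E \<subseteq> K" "k\<^sub>0 \<in> E" "finite E'" "E' \<subseteq> K" "k\<^sub>0 \<in> E'"
      "b p (e k\<^sub>0 + x (E, F)) \<noteq> 0" "b p (e k\<^sub>0 + x (E', F)) \<noteq> 0" for E E'
    proof (rule ccontr)
      assume "E \<noteq> E'"
      then have "1 / 2 \<le> \<Delta>\<^sub>0 (e k\<^sub>0 + x (E, F)) (e k\<^sub>0 + x (E', F))"
        using that F by (intro x) (auto simp: J_def Fpow_def)
      moreover have "\<Delta>\<^sub>0 (e k\<^sub>0 + x (E, F)) (e k\<^sub>0 + p) < 1 / 4"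
        "\<Delta>\<^sub>0 (e k\<^sub>0 + x (E', F)) (e k\<^sub>0 + p) < 1 / 4"
        using that(7,8) by (auto simp: b_def max_def split: if_splits)
      ultimately show False
        using RP_D(4)[OF \<Delta>\<^sub>0, of "e k\<^sub>0 + x (E, F)" "e k\<^sub>0 + x (E', F)" "e k\<^sub>0 + p"]
          RP_D(3)[OF \<Delta>\<^sub>0, of "e k\<^sub>0 + p"] by simp
    qed
    have "\<forall>\<^sub>F E in Q. b p (e k\<^sub>0 + x (E, F)) = 0"
    proof (cases "\<exists>E\<^sub>1. finite E\<^sub>1 \<and> E\<^sub>1 \<subseteq> K \<and> k\<^sub>0 \<in> E\<^sub>1 \<and> b p (e k\<^sub>0 + x (E\<^sub>1, F)) \<noteq> 0")
      case True
      then obtain E\<^sub>1 where E\<^sub>1: "finite E\<^sub>1" "E\<^sub>1 \<subseteq> K" "k\<^sub>0 \<in> E\<^sub>1" "b p (e k\<^sub>0 + x (E\<^sub>1, F)) \<noteq> 0"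
        by blast
      then obtain k where "k \<in> K - E\<^sub>1"
        using K by (metis finite_subset subsetI Diff_iff)
      then have "\<forall>\<^sub>F E in Q. finite E \<and> E \<subseteq> K \<and> {k\<^sub>0, k} \<subseteq> E"
        using k\<^sub>0 by (intro Q_ev) auto
      then show ?thesis
        by eventually_elim (use small E\<^sub>1 \<open>k \<in> K - E\<^sub>1\<close> in blast)
    next
      case False
      have "\<forall>\<^sub>F E in Q. finite E \<and> E \<subseteq> K \<and> {k\<^sub>0} \<subseteq> E"
        using k\<^sub>0 by (intro Q_ev) auto
      then show ?thesis
        by eventually_elim (use False in blast)
    qed
    then show "((\<lambda>E. bt p (x (E, F))) \<longlongrightarrow> 0) Q"
      by (intro tendsto_eventually) (simp add: bt_def ltrans_def)
  qed
  have Fpow_ev: "\<forall>\<^sub>F F in Q. F \<in> Fpow K"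
    using Q_ev[of "{}"] by (simp add: Fpow_def conj_commute)
  have bt_\<nu>: "\<nu> (bt p) = 0" for p
    by (rule \<nu>_eq[OF bt_LUC], rule tendsto_eventually)
      (use Fpow_ev in eventually_elim, rule bt_\<nu>F)
  have not_point: "t \<notin> range point_eval" if "\<And>p. t (bt p) = 0" for t
  proof
    assume "t \<in> range point_eval"
    then obtain p where "t = point_eval p" by blast
    then have "t (bt p) = 1"
      using bt_LUC by (simp add: point_eval_def bt_def ltrans_def b_def RP_D(1)[OF \<Delta>\<^sub>0])
    then show False
      using that by simp
  qed

  \<comment> \<open>A net whose tail filter is the trace of \<open>H\<close> on the \<open>\<nu>F F\<close>.\<close>
  define T where "T = \<nu>F ` Fpow K"
  \<comment> \<open>Because of \<open>s \<in> T\<close>, every term of the net, and not just a tail,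
    is some \<open>\<nu>F F\<close> with \<open>F \<in> Fpow K\<close>.\<close>
  define \<Gamma> where "\<Gamma> = {(S, s). eventually (\<lambda>t. t \<in> S) H \<and> s \<in> S \<and> s \<in> T}"
  define le :: "(('a \<Rightarrow> complex) \<Rightarrow> complex) net_index \<Rightarrow> (('a \<Rightarrow> complex) \<Rightarrow> complex) net_index \<Rightarrow> bool"
    where "le a c \<longleftrightarrow> fst c \<subseteq> fst a" for a c
  have T_ev: "\<forall>\<^sub>F t in H. t \<in> T"
    by (rule filter_leD[OF H(2)])
      (use Fpow_ev in \<open>auto simp: eventually_filtermap T_def elim: eventually_mono\<close>)
  have ex: "\<exists>s. (S, s) \<in> \<Gamma>" if "\<forall>\<^sub>F t in H. t \<in> S" for S
    using eventually_happens'[OF H(1) eventually_conj[OF that T_ev]] that by (auto simp: \<Gamma>_def)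
  have dir: "directed \<Gamma> le"
  proof -
    have "\<Gamma> \<noteq> {}"
      using ex[of UNIV] by auto
    moreover have "\<exists>c\<in>\<Gamma>. le a c \<and> le a' c" if "a \<in> \<Gamma>" "a' \<in> \<Gamma>" for a a'
    proof -
      have "\<forall>\<^sub>F t in H. t \<in> fst a \<inter> fst a'"
        using that by (auto simp: \<Gamma>_def eventually_conj)
      then obtain s where "(fst a \<inter> fst a', s) \<in> \<Gamma>"
        using ex by blast
      then show ?thesis
        by (intro bexI[of _ "(fst a \<inter> fst a', s)"]) (auto simp: le_def)
    qed
    ultimately show ?thesis
      unfolding directed_def by (auto simp: le_def)
  qed
  have along: "\<forall>\<^sub>F \<gamma> in along \<Gamma> le. P (snd \<gamma>)" if "\<forall>\<^sub>F t in H. P t" for P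
  proof -
    obtain s where "({t. P t}, s) \<in> \<Gamma>"
      using ex[of "{t. P t}"] \<open>\<forall>\<^sub>F t in H. P t\<close> by auto
    then show ?thesis
      unfolding eventually_along[OF dir] by (intro bexI[of _ "({t. P t}, s)"]) (auto simp: le_def \<Gamma>_def)
  qed
  have net_lim: "limitin (subtopology weak_star G_LUC) snd \<nu> (along \<Gamma> le)"
    unfolding limitin_subtopology
  proof (intro conjI)
    show "\<forall>\<^sub>F \<gamma> in along \<Gamma> le. snd \<gamma> \<in> G_LUC"
      by (rule along, use T_ev in eventually_elim) (use \<nu>F(2) in \<open>auto simp: T_def\<close>)
    show "limitin weak_star snd \<nu> (along \<Gamma> le)"
      using lim along unfolding limitin_def by blast
  qed (rule \<nu>)

  \<comment> \<open>Convergence of the convolutions forces continuity of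
    \<open>\<mu>\<close>\<close>
  have "\<mu> \<in> uniform_measures" if \<mu>: "\<mu> \<in> LUC_dual"
    and conv: "limitin weak_star (\<lambda>\<gamma>. \<mu> \<star> snd \<gamma>) (\<mu> \<star> \<nu>) (along \<Gamma> le)" for \<mu>
  proof (rule ccontr)
    assume "\<mu> \<notin> uniform_measures"
    from not_uniform_measureD[OF \<mu> this]
    obtain \<Delta> h \<epsilon> where \<Delta>: "\<Delta> \<in> RP" and h: "h \<in> BLip \<Delta>" and \<epsilon>: "\<epsilon> > 0"
      and approx: "\<And>Z \<delta>. finite Z \<Longrightarrow> \<delta> > 0 \<Longrightarrow>
        \<exists>g\<in>BLip \<Delta>. (\<forall>z\<in>Z. dist (g z) (h z) < \<delta>) \<and> \<epsilon> \<le> dist (\<mu> g) (\<mu> h)"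
      by blast
    obtain e' where e': "\<And>y \<epsilon>. \<epsilon> > 0 \<Longrightarrow> \<exists>k\<in>K. \<Delta> y (e' k) < \<epsilon>"
      using RP_dense_enumeration[OF r \<Delta>] unfolding K_def by blast
    \<comment> \<open>The tolerance shrinks with the size of \<open>F\<close>, so that enlarging
      \<open>F\<close> refines both the points and the precision.\<close>
    have "\<forall>F\<in>Fpow K. \<exists>g\<in>BLip \<Delta>. (\<forall>k\<in>F. dist (g (e' k)) (h (e' k)) < 1 / Suc (card F)) \<and>
        \<epsilon> \<le> dist (\<mu> g) (\<mu> h)"
    proof
      fix F assume "F \<in> Fpow K"
      then have "finite (e' ` F)"
        by (simp add: Fpow_def)
      from approx[OF this, of "1 / Suc (card F)"]
      show "\<exists>g\<in>BLip \<Delta>. (\<forall>k\<in>F. dist (g (e' k)) (h (e' k)) < 1 / Suc (card F)) \<and>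
          \<epsilon> \<le> dist (\<mu> g) (\<mu> h)"
        by simp
    qed
    then obtain g where g: "\<And>F. F \<in> Fpow K \<Longrightarrow> g F \<in> BLip \<Delta>"
      "\<And>F k. F \<in> Fpow K \<Longrightarrow> k \<in> F \<Longrightarrow> dist (g F (e' k)) (h (e' k)) < 1 / Suc (card F)"
      "\<And>F. F \<in> Fpow K \<Longrightarrow> \<epsilon> \<le> dist (\<mu> (g F)) (\<mu> h)"
      by metis
    have "\<forall>F\<in>Fpow K. \<exists>u. g F = (\<lambda>x. complex_of_real (u x)) \<and> (\<forall>x. u x \<in> {0..1}) \<and>
        (\<forall>x y. \<bar>u x - u y\<bar> \<le> \<Delta> x y)"
      using g(1) unfolding BLip_def by blast
    then obtain u where u: "\<And>F. F \<in> Fpow K \<Longrightarrow> g F = (\<lambda>x. complex_of_real (u F x))"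
      "\<And>F x. F \<in> Fpow K \<Longrightarrow> u F x \<in> {0..1}"
      "\<And>F x y. F \<in> Fpow K \<Longrightarrow> \<bar>u F x - u F y\<bar> \<le> \<Delta> x y"
      by metis
    \<comment> \<open>The prescribed function depends on \<open>F\<close> alone, so the limit over
      \<open>E\<close> recovers it.\<close>
    obtain f where f01: "\<And>z. f z \<in> {0..1::real}"
      and f_lip: "\<And>z w. \<bar>f z - f w\<bar> \<le> \<Delta> z w + 8 * \<Delta>\<^sub>0 z w"
      and f_val: "\<And>E F d y. (E, F) \<in> J \<Longrightarrow> d \<in> E \<Longrightarrow> \<Delta>\<^sub>0 y (e d) < 1 / 8 \<Longrightarrow>
        f (y + x (E, F)) = u F y"
      using interpolate_on_separated_translates[OF \<Delta> \<Delta>\<^sub>0, of J fst e x "\<lambda>j. u (snd j)"] x u(2,3)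
      by (fastforce simp: J_def)
    define f' where "f' z = complex_of_real (f z)" for z
    have f'_LUC: "ltrans y f' \<in> LUC" for y
      unfolding f'_def by (rule ltrans_in_LUC[OF \<Delta> \<Delta>\<^sub>0 f01 f_lip])
    have \<nu>F_f: "\<nu>F F (ltrans y f') = g F y" if F: "F \<in> Fpow K" for F y
    proof (rule \<nu>F(3)[OF f'_LUC])
      \<comment> \<open>Once \<open>E\<close> contains this \<open>k\<close>, the point
        \<open>y\<close> lies where \<open>f\<close> interpolates, and the values are constant from
        there on.\<close>
      obtain k where k: "k \<in> K" "\<Delta>\<^sub>0 y (e k) < 1 / 8"
        using e[of "1 / 8" y] by auto
      then have "\<forall>\<^sub>F E in Q. finite E \<and> E \<subseteq> K \<and> {k} \<subseteq> E"
        by (intro Q_ev) auto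
      then have "\<forall>\<^sub>F E in Q. ltrans y f' (x (E, F)) = g F y"
      proof eventually_elim
        case (elim E)
        then have "f (y + x (E, F)) = u F y"
          using k F by (intro f_val[of E F k]) (auto simp: J_def Fpow_def)
        then show ?case
          using u(1)[OF F] by (simp add: ltrans_def f'_def)
      qed
      then show "((\<lambda>E. ltrans y f' (x (E, F))) \<longlongrightarrow> g F y) Q"
        by (rule tendsto_eventually)
    qed
    have lip: "dist (v y) (v z) \<le> \<Delta> y z" if "v \<in> BLip \<Delta>" for v y z
      using that unfolding BLip_def by (auto simp: dist_norm simp flip: of_real_diff)
    \<comment> \<open>Closeness at the dense points \<open>e' k\<close> spreads to every
      \<open>y\<close> through the common Lipschitz bound. The set \<open>X\<close> below forces
      \<open>F\<close> to have at least \<open>n\<close> elements.\<close>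
    have g_lim: "((\<lambda>F. g F y) \<longlongrightarrow> h y) Q" for y
      unfolding tendsto_iff
    proof (intro allI impI)
      fix \<delta> :: real assume \<delta>: "\<delta> > 0"
      then have \<delta>3: "\<delta> / 3 > 0" by simp
      obtain k where k: "k \<in> K" "\<Delta> y (e' k) < \<delta> / 3"
        using e'[OF \<delta>3] by blast
      obtain n where n: "1 / Suc n < \<delta> / 3"
        by (rule nat_approx_posE[OF \<delta>3])
      obtain X where X: "finite X" "card X = n" "X \<subseteq> K"
        using infinite_arbitrarily_large[OF K] by blast
      have "\<forall>\<^sub>F F in Q. finite F \<and> F \<subseteq> K \<and> insert k X \<subseteq> F"
        using X k by (intro Q_ev) auto
      then show "\<forall>\<^sub>F F in Q. dist (g F y) (h y) < \<delta>"
      proof eventually_elim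
        case (elim F)
        then have F: "F \<in> Fpow K" "k \<in> F"
          by (auto simp: Fpow_def)
        have "n \<le> card F"
          using elim X(2) by (auto intro: card_mono)
        then have "1 / Suc (card F) \<le> 1 / Suc n"
          by (intro divide_left_mono) auto
        then have "dist (g F (e' k)) (h (e' k)) < \<delta> / 3"
          using g(2)[OF F] n by linarith
        moreover have "dist (g F y) (g F (e' k)) < \<delta> / 3" "dist (h (e' k)) (h y) < \<delta> / 3"
          using lip[OF g(1)[OF F(1)], of y "e' k"] lip[OF h, of y "e' k"] k(2)
          by (simp_all add: dist_commute)
        ultimately show ?case
          using dist_triangle[of "g F y" "h y" "g F (e' k)"]
            dist_triangle[of "g F (e' k)" "h y" "h (e' k)"] by linarith
      qed
    qed
    have \<nu>_f: "\<nu> (ltrans y f') = h y" for y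
    proof (rule \<nu>_eq[OF f'_LUC])
      have "\<forall>\<^sub>F F in Q. g F y = \<nu>F F (ltrans y f')"
        using Fpow_ev by eventually_elim (simp add: \<nu>F_f)
      then show "((\<lambda>F. \<nu>F F (ltrans y f')) \<longlongrightarrow> h y) Q"
        by (rule Lim_transform_eventually[OF g_lim])
    qed
    have "f' \<in> LUC"
      using f'_LUC[of 0] by (simp add: ltrans_def)
    then have "((\<lambda>\<gamma>. \<mu> (snd \<gamma> \<bullet>\<^sub>L f')) \<longlongrightarrow> \<mu> (\<nu> \<bullet>\<^sub>L f')) (along \<Gamma> le)"
      using conv by (simp add: limitin_weak_star_iff conv_def)
    then have "\<forall>\<^sub>F \<gamma> in along \<Gamma> le. dist (\<mu> (snd \<gamma> \<bullet>\<^sub>L f')) (\<mu> (\<nu> \<bullet>\<^sub>L f')) < \<epsilon>"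
      using \<epsilon> unfolding tendsto_iff by blast
    then obtain \<gamma> where "\<gamma> \<in> \<Gamma>" and \<gamma>: "dist (\<mu> (snd \<gamma> \<bullet>\<^sub>L f')) (\<mu> (\<nu> \<bullet>\<^sub>L f')) < \<epsilon>"
      unfolding eventually_along[OF dir] by (auto simp: le_def)
    then obtain F where F: "F \<in> Fpow K" "snd \<gamma> = \<nu>F F"
      by (auto simp: \<Gamma>_def T_def)
    \<comment> \<open>Both are exact equalities of functions on the group, so the arbitrary
      functional \<open>\<mu>\<close> can be applied to them.\<close>
    have "snd \<gamma> \<bullet>\<^sub>L f' = g F" "\<nu> \<bullet>\<^sub>L f' = h"
      using F \<nu>F_f \<nu>_f by (auto simp: luc_act_def)
    then show False
      using \<gamma> g(3)[OF F(1)] by simp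
  qed
  moreover have "\<forall>\<gamma>\<in>\<Gamma>. snd \<gamma> \<in> G_LUC - range point_eval"
    using not_point bt_\<nu>F \<nu>F(2) by (auto simp: \<Gamma>_def T_def)
  moreover have "\<nu> \<in> G_LUC - range point_eval"
    using \<nu> not_point bt_\<nu> by blast
  ultimately show ?thesis
    using dir net_lim by blast
qed

end
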